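(* Let $c,k$ be fixed positive integers and let $s=s(n)$ be a positive-integer-valued function. (1) If $c=k+1$ and $s(n)>c$ for all $n$, then $p(n,c,k,s(n))=1-o(1)$, i.e. $\lim_{n\to\infty}p(n,c,k,s(n))=1$. (2) If $c>k+1$ and $s(n)\ge c$ for all $n$, then $p(n,c,k,s(n))=1-o(1)$, i.e. $\lim_{n\to\infty}p(n,c,k,s(n))=1$.
   Context: $C_n^k$ denotes the $k$-th power of the cycle on $n$ vertices: its vertex set is $\{0,\ldots,n-1\}$, and distinct vertices $i,j$ are adjacent iff $(i-j) \bmod n\in\{-k,\ldots,-1,1,\ldots,k\}$ (residues modulo $n$), i.e. iff their distance along the cycle is at most $k$. Given a set $L(x)$ of colours for each vertex $x$ of a graph $G$, an $L$-colouring of $G$ is a map $f$ from $V(G)$ to the colours with $f(x)\in L(x)$ for all $x\in V(G)$ and $f(x)\ne f(y)$ for every edge $(x,y)\in E(G)$; $G$ is $L$-colourable if it has an $L$-colouring. Let $\mathcal{S}$ be a set of colours of size $s(n)$. For each vertex of $C_n^k$, independently, draw a subset of $\mathcal{S}$ of size $c$ uniformly at random among all $c$-element subsets of $\mathcal{S}$; this gives a random list assignment $L$. Then $p(n,c,k,s(n))$ is the probability that $C_n^k$ is $L$-colourable. The parameters $c,k$ are fixed, $s(n)$ may depend arbitrarily on $n$ subject to the stated inequality, and all asymptotics are as $n\to\infty$; $o(1)$ denotes a quantity tending to $0$. *)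

theory Defs
  imports "HOL-Probability.Probability" "HOL-Number_Theory.Cong" "Graph_Theory.Pair_Digraph"
begin

definition cycle_power :: "nat \<Rightarrow> nat \<Rightarrow> nat pair_pre_digraph" where
  "cycle_power n k =
     \<lparr> pverts = {..<n},
       parcs = {(i, j). i < n \<and> j < n \<and> i \<noteq> j \<and>
                  (\<exists>d \<in> {- int k..- 1} \<union> {1..int k}. [int i - int j = d] (mod int n))} \<rparr>"

lemma pair_graph_cycle_power: "pair_graph (cycle_power n k)"
proof
  show "finite (pverts (cycle_power n k))"
    by (simp add: cycle_power_def)
  show "finite (parcs (cycle_power n k))"
    by (rule finite_subset[of _ "{..<n} \<times> {..<n}"]) (auto simp: cycle_power_def)
  show "symmetric (with_proj (cycle_power n k))"
  proof (rule ccontr)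
    assume "\<not> ?thesis"
    then obtain i j where ij: "(i, j) \<in> parcs (cycle_power n k)" "(j, i) \<notin> parcs (cycle_power n k)"
      by (auto simp: symmetric_def sym_def arcs_ends_conv)
    from ij(1) have "\<exists>d \<in> {- int k..- 1} \<union> {1..int k}. [int i - int j = d] (mod int n)"
      unfolding cycle_power_def by simp
    then obtain d where d: "d \<in> {- int k..- 1} \<union> {1..int k}" "[int i - int j = d] (mod int n)"
      by blast
    have "[int j - int i = - d] (mod int n)"
      using cong_minus_minus_iff[of "int i - int j" d "int n"] d(2) by simp
    moreover have "- d \<in> {- int k..- 1} \<union> {1..int k}" using d(1) by auto
    ultimately have "(j, i) \<in> parcs (cycle_power n k)"
      using ij(1) unfolding cycle_power_def by (simp del: Un_iff) blast
    with ij(2) show False by simp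
  qed
qed (auto simp: cycle_power_def)

text \<open>Only the values of \<open>L\<close> and \<open>f\<close> on the vertices of \<open>G\<close> matter.\<close>

definition list_colouring ::
    "('v, 'e) pre_digraph \<Rightarrow> ('v \<Rightarrow> 'a set) \<Rightarrow> ('v \<Rightarrow> 'a) \<Rightarrow> bool" where
  "list_colouring G L f \<longleftrightarrow>
     (\<forall>x \<in> verts G. f x \<in> L x) \<and> (\<forall>(x, y) \<in> arcs_ends G. f x \<noteq> f y)"

definition list_colourable :: "('v, 'e) pre_digraph \<Rightarrow> ('v \<Rightarrow> 'a set) \<Rightarrow> bool" where
  "list_colourable G L \<longleftrightarrow> (\<exists>f. list_colouring G L f)"

text \<open>
  Independent lists, each uniform among the \<open>c\<close>-element subsets of \<open>S\<close>; this is meaningful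
  when \<open>S\<close> is finite with at least \<open>c\<close> elements. Outside the vertex set \<open>{..<n}\<close> the list
  assignment takes the dummy value \<open>{}\<close>.
\<close>

definition random_lists :: "nat \<Rightarrow> nat \<Rightarrow> 'a set \<Rightarrow> (nat \<Rightarrow> 'a set) pmf" where
  "random_lists n c S = Pi_pmf {..<n} {} (\<lambda>_. pmf_of_set {A. A \<subseteq> S \<and> card A = c})"

text \<open>
  The probability \<open>p(n,c,k,s)\<close>, with the underlying set \<open>S\<close> of \<open>s\<close> colours as an argument
  instead of its size.
\<close>

definition colourable_prob :: "nat \<Rightarrow> nat \<Rightarrow> nat \<Rightarrow> 'a set \<Rightarrow> real" where
  "colourable_prob n c k S =
     measure_pmf.prob (random_lists n c S) {L. list_colourable (with_proj (cycle_power n k)) L}"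

end

theory Submission
  imports Defs
begin

text \<open>
  Along the path, vertices have at most \<open>k\<close> earlier neighbours, so lists of more than \<open>k\<close> colours
  can be coloured greedily; only closing up the cycle is a problem. It is solved by a window of
  boundedly many consecutive vertices with favourable lists. If there are at least
  \<open>c (k + 1)\<close> colours, then \<open>k + 1\<close> pairwise disjoint lists suffice: each window vertex has
  at most \<open>k\<close> neighbours outside the window. If there are fewer colours, fix \<open>k + 2\<close> of them. On blocks of
  \<open>k + 1\<close> vertices whose lists omit one of these, the colouring is a sliding puzzle with one
  spare colour, and a suitable sequence of omitted colours leads from every colouring of the
  preceding vertices to one and the same final colouring. So one starts from this final colouring,
  continues greedily around the cycle and uses the window to return to the start. In both cases a
  given window is favourable with probability at least some positive constant which does not depend
  on the set of colours, and disjoint windows are independent.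
\<close>

section \<open>Colourings of paths with greedy extension\<close>

text \<open>A proper colouring of the \<open>k\<close>-th power of a path, listed along the path. As
  a property of lists, it lets pieces of the cycle be glued by concatenation.\<close>

definition spaced :: "nat \<Rightarrow> 'a list \<Rightarrow> bool" where
  "spaced k xs \<longleftrightarrow> (\<forall>i j. i < j \<and> j \<le> i + k \<and> j < length xs \<longrightarrow> xs ! i \<noteq> xs ! j)"

lemma spacedD: "spaced k xs \<Longrightarrow> i < j \<Longrightarrow> j \<le> i + k \<Longrightarrow> j < length xs \<Longrightarrow> xs ! i \<noteq> xs ! j"
  by (auto simp: spaced_def)

lemma spaced_appendD2:
  assumes "spaced k (xs @ ys)"
  shows "spaced k ys"
  unfolding spaced_def
proof (intro allI impI)
  fix i j assume "i < j \<and> j \<le> i + k \<and> j < length ys"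
  then show "ys ! i \<noteq> ys ! j"
    using spacedD[OF assms, of "length xs + i" "length xs + j"] by simp
qed

text \<open>Two positions at distance at most \<open>k\<close> cannot lie one in \<open>xs\<close>
  and one in \<open>zs\<close>, as the at least \<open>k\<close> entries of \<open>ys\<close>
  separate them; so every conflict is visible in one of the two overlapping pieces.\<close>

lemma spaced_append_overlap:
  assumes "spaced k (xs @ ys)" "spaced k (ys @ zs)" "k \<le> length ys"
  shows "spaced k (xs @ ys @ zs)"
  unfolding spaced_def
proof (intro allI impI)
  fix i j assume *: "i < j \<and> j \<le> i + k \<and> j < length (xs @ ys @ zs)"
  show "(xs @ ys @ zs) ! i \<noteq> (xs @ ys @ zs) ! j"
  proof (cases "j < length (xs @ ys)")
    case True
    then show ?thesis
      using spacedD[OF assms(1), of i j] * by (auto simp flip: append_assoc simp: nth_append)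
  next
    case False
    then have "length xs \<le> i" "length xs \<le> j" using * assms(3) by auto
    then obtain i' j' where "i = length xs + i'" "j = length xs + j'"
      by (metis le_Suc_ex)
    then show ?thesis
      using spacedD[OF assms(2), of i' j'] * by simp
  qed
qed

lemma spaced_short_iff_distinct:
  assumes "length xs \<le> Suc k"
  shows "spaced k xs \<longleftrightarrow> distinct xs"
proof
  assume "spaced k xs"
  then show "distinct xs"
  proof -
    have "xs ! i \<noteq> xs ! j" if "i < j" "j < length xs" for i j
      using \<open>spaced k xs\<close> assms that by (intro spacedD[of k xs]) auto
    then show ?thesis by (auto simp: distinct_conv_nth neq_iff) metis
  qed
next
  assume "distinct xs"
  then show "spaced k xs"
    by (auto simp: spaced_def nth_eq_iff_index_eq)
qed

text \<open>By truncated subtraction \<open>drop (length xs - k) xs\<close> consists of the last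
  \<open>k\<close> entries, or of all entries if there are fewer: the earlier neighbours of the new
  vertex.\<close>

lemma spaced_snoc:
  assumes "spaced k xs" "x \<notin> set (drop (length xs - k) xs)"
  shows "spaced k (xs @ [x])"
  unfolding spaced_def
proof (intro allI impI)
  fix i j assume *: "i < j \<and> j \<le> i + k \<and> j < length (xs @ [x])"
  show "(xs @ [x]) ! i \<noteq> (xs @ [x]) ! j"
  proof (cases "j < length xs")
    case True
    then show ?thesis using spacedD[OF assms(1), of i j] * by (simp add: nth_append)
  next
    case False
    then have j: "j = length xs" using * by simp
    then have "drop (length xs - k) xs ! (i - (length xs - k)) = xs ! i"
      using * by (subst nth_drop) auto
    moreover have "i - (length xs - k) < length (drop (length xs - k) xs)"
      using * j by auto
    ultimately have "xs ! i \<in> set (drop (length xs - k) xs)"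
      by (metis nth_mem)
    then show ?thesis using assms(2) * j by (auto simp: nth_append)
  qed
qed

lemma greedy_spaced_extension:
  assumes "spaced k xs" "\<And>W. W \<in> set Ws \<Longrightarrow> k < card W"
  shows "\<exists>ys. list_all2 (\<in>) ys Ws \<and> spaced k (xs @ ys)"
  using assms
proof (induction Ws arbitrary: xs)
  case Nil
  then show ?case by auto
next
  case (Cons W Ws)
  have "card (set (drop (length xs - k) xs)) \<le> k"
    by (rule order.trans[OF card_length]) simp
  moreover have "k < card W" using Cons.prems(2) by simp
  ultimately have "\<not> W \<subseteq> set (drop (length xs - k) xs)"
    by (metis List.finite_set card_mono leD order.trans)
  then obtain y where y: "y \<in> W" "y \<notin> set (drop (length xs - k) xs)" by auto
  obtain ys where "list_all2 (\<in>) ys Ws" "spaced k ((xs @ [y]) @ ys)"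
    using Cons.IH[OF spaced_snoc[OF Cons.prems(1) y(2)]] Cons.prems(2) by auto
  then show ?case using y by (intro exI[of _ "y # ys"]) simp
qed

section \<open>The sliding puzzle\<close>

text \<open>The colours of the most recent \<open>length u\<close> vertices form a state. The word
  \<open>Ws\<close> of lists then acts as a relation between the state \<open>u\<close> before it
  and a state \<open>v\<close> after it; dropping \<open>length ys\<close> entries keeps exactly the
  last \<open>length u\<close> ones.\<close>

definition extends_to :: "nat \<Rightarrow> 'a set list \<Rightarrow> 'a list \<Rightarrow> 'a list \<Rightarrow> bool" where
  "extends_to k Ws u v \<longleftrightarrow>
     (\<exists>ys. list_all2 (\<in>) ys Ws \<and> spaced k (u @ ys) \<and> drop (length ys) (u @ ys) = v)"

lemma extends_to_append:
  assumes "extends_to k Ws u v" "extends_to k Vs v w" "k \<le> length u"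
  shows "extends_to k (Ws @ Vs) u w"
proof -
  obtain ys where ys: "list_all2 (\<in>) ys Ws" "spaced k (u @ ys)" "drop (length ys) (u @ ys) = v"
    using assms(1) by (auto simp: extends_to_def)
  obtain zs where zs: "list_all2 (\<in>) zs Vs" "spaced k (v @ zs)" "drop (length zs) (v @ zs) = w"
    using assms(2) by (auto simp: extends_to_def)
  \<comment> \<open>Splitting \<open>u @ ys\<close> as \<open>p @ v\<close> exposes \<open>v\<close>
    as the overlap of the two extensions; it is long enough because it has the length of
    \<open>u\<close>.\<close>
  define p where "p = take (length ys) (u @ ys)"
  have split: "u @ ys = p @ v" using ys(3) append_take_drop_id[of "length ys" "u @ ys"]
    unfolding p_def by simp
  have p: "length p = length ys" by (simp add: p_def)
  have "length v = length u" using ys(3) by auto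
  then have "spaced k (p @ v @ zs)"
    using spaced_append_overlap[of k p v zs] ys(2) zs(2) assms(3) split by simp
  then have "spaced k (u @ ys @ zs)" using split by (metis append.assoc)
  moreover have "drop (length (ys @ zs)) (u @ ys @ zs) = w"
  proof -
    have "u @ ys @ zs = p @ v @ zs" using split by (metis append.assoc)
    then have "drop (length (ys @ zs)) (u @ ys @ zs) = drop (length zs) (drop (length p) (p @ v @ zs))"
      by (simp only: p length_append drop_drop add.commute)
    then show ?thesis using zs(3) by simp
  qed
  moreover have "list_all2 (\<in>) (ys @ zs) (Ws @ Vs)"
    using ys(1) zs(1) by (rule list_all2_appendI)
  ultimately show ?thesis unfolding extends_to_def by blast
qed

text \<open>Position \<open>i\<close> of a block and position \<open>j\<close> of the next are at
  distance \<open>k + 1 + j - i\<close>, which is at most \<open>k\<close> exactly if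
  \<open>j < i\<close>. So a colour may keep its position or move to a later one, but not to an
  earlier one.\<close>

lemma extends_to_block:
  assumes "length u = Suc k" "distinct u" "length v = Suc k" "distinct v" "set v \<subseteq> W"
    and "\<And>i j. j < i \<Longrightarrow> i < Suc k \<Longrightarrow> v ! j \<noteq> u ! i"
  shows "extends_to k (replicate (Suc k) W) u v"
proof -
  have "spaced k (u @ v)"
    unfolding spaced_def
  proof (intro allI impI)
    fix i j assume *: "i < j \<and> j \<le> i + k \<and> j < length (u @ v)"
    show "(u @ v) ! i \<noteq> (u @ v) ! j"
    proof (cases "i < Suc k \<and> Suc k \<le> j")
      case True
      then have "v ! (j - Suc k) \<noteq> u ! i" using * by (intro assms(6)) auto
      then show ?thesis using True assms(1) by (simp add: nth_append)
    next
      case False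
      then show ?thesis using * assms by (auto simp: nth_append nth_eq_iff_index_eq)
    qed
  qed
  moreover have "list_all2 (\<in>) v (replicate (Suc k) W)"
    using assms(3,5) by (auto simp del: replicate_Suc simp: list_all2_conv_all_nth)
  ultimately show ?thesis unfolding extends_to_def using assms(1,3) by (intro exI[of _ v]) simp
qed

text \<open>
  A word \<open>ms\<close> of colours stands for consecutive blocks of \<open>k + 1\<close> equal lists \<open>T - {m}\<close>. A
  colouring of a block uses all colours of \<open>T\<close> but one, the spare colour.
\<close>

definition omitting :: "nat \<Rightarrow> 'a set \<Rightarrow> 'a list \<Rightarrow> 'a set list" where
  "omitting k T ms = concat (map (\<lambda>m. replicate (Suc k) (T - {m})) ms)"

lemma omitting_simps [simp]:
  "omitting k T [] = []"
  "omitting k T (m # ms) = replicate (Suc k) (T - {m}) @ omitting k T ms"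
  "omitting k T (ms @ ns) = omitting k T ms @ omitting k T ns"
  by (simp_all add: omitting_def)

lemma length_omitting [simp]: "length (omitting k T ms) = Suc k * length ms"
  by (induction ms) (simp_all del: replicate_Suc)

lemma in_set_omittingD: "W \<in> set (omitting k T ms) \<Longrightarrow> \<exists>m \<in> set ms. W = T - {m}"
  by (auto simp: omitting_def simp del: replicate_Suc)

abbreviation swap_colours :: "'a \<Rightarrow> 'a \<Rightarrow> 'a list \<Rightarrow> 'a list" where
  "swap_colours x y \<equiv> map (Transposition.transpose x y)"

lemma distinct_swap_colours [simp]: "distinct (swap_colours x y u) \<longleftrightarrow> distinct u"
  by (simp add: distinct_map inj_on_subset[OF inj_transpose])

lemma set_swap_colours [simp]: "x \<in> set u \<Longrightarrow> y \<in> set u \<Longrightarrow> set (swap_colours x y u) = set u"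
  by (simp add: transpose_image_eq)

text \<open>The transposition permutes \<open>insert z (set u)\<close>, which is all of
  \<open>T\<close>, so only the spare colour changes, from \<open>z\<close> to
  \<open>m\<close>.\<close>

lemma set_swap_colours_unused:
  assumes "set u = T - {z}" "m \<in> T" "z \<in> T"
  shows "set (swap_colours m z u) = T - {m}"
proof (cases "m = z")
  case False
  have "Transposition.transpose m z ` insert z (set u) = insert z (set u)"
    using assms by (intro transpose_image_eq) auto
  moreover have "Transposition.transpose m z ` insert z (set u)
      = insert m (set (swap_colours m z u))"
    by simp
  moreover have "m \<notin> set (swap_colours m z u)"
    using assms False by (auto simp: Transposition.transpose_def)
  ultimately show ?thesis using assms by auto
qed (use assms in simp)

text \<open>One move of the puzzle: the vertex coloured \<open>m\<close> takes the spare colour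
  \<open>z\<close>, and all other colours stay in place. No conflict arises, as \<open>z\<close>
  does not occur in \<open>u\<close>. For \<open>m = z\<close> the block is copied.\<close>

lemma extends_to_omitting:
  assumes "length u = Suc k" "distinct u" "set u = T - {z}" "z \<in> T" "m \<in> T"
  shows "extends_to k (omitting k T [m]) u (swap_colours m z u)"
proof -
  have "swap_colours m z u ! j \<noteq> u ! i" if ij: "j < i" "i < Suc k" for i j
  proof -
    have "u ! j \<noteq> u ! i" using assms(1,2) ij by (simp add: nth_eq_iff_index_eq)
    moreover have "u ! i \<in> set u" using ij assms(1) by (metis nth_mem)
    then have "u ! i \<noteq> z" using assms(3) by blast
    moreover have "swap_colours m z u ! j = Transposition.transpose m z (u ! j)"
      using ij assms(1) by (intro nth_map) simp
    moreover have "u ! j \<in> set u" using ij assms(1) by (metis nth_mem less_trans)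
    then have "u ! j \<noteq> z" using assms(3) by blast
    ultimately show ?thesis by (simp add: Transposition.transpose_def)
  qed
  then have "extends_to k (replicate (Suc k) (T - {m})) u (swap_colours m z u)"
    using assms(1,2) set_swap_colours_unused[OF assms(3,5,4)]
    by (intro extends_to_block) (auto simp only: length_map distinct_swap_colours)
  then show ?thesis by (simp del: replicate_Suc)
qed

lemma extends_to_three:
  assumes "extends_to k (omitting k T [x]) u v" "extends_to k (omitting k T [y]) v w"
    "extends_to k (omitting k T [z]) w t" "length u = Suc k" "length v = Suc k"
  shows "extends_to k (omitting k T [x, y, z]) u t"
proof -
  have "extends_to k (omitting k T [y] @ omitting k T [z]) v t"
    using assms by (intro extends_to_append[of k _ v w]) auto
  then have "extends_to k (omitting k T [x] @ omitting k T [y] @ omitting k T [z]) u t"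
    using assms by (intro extends_to_append[of k _ u v]) auto
  then show ?thesis by (simp del: replicate_Suc)
qed

text \<open>Three moves rotate the colours through the spare one: \<open>x\<close> becomes
  \<open>z\<close>, then \<open>y\<close> becomes \<open>x\<close>, then \<open>z\<close> becomes
  \<open>y\<close>, and \<open>z\<close> is spare again.\<close>

lemma extends_to_swap:
  assumes "length u = Suc k" "distinct u" "set u = T - {z}" "z \<in> T" "x \<in> set u" "y \<in> set u"
  shows "extends_to k (omitting k T [x, y, z]) u (swap_colours x y u)"
proof (rule extends_to_three)
  define v where "v = swap_colours x z u"
  define w where "w = swap_colours y x v"
  have v: "length v = Suc k" "distinct v" "set v = T - {x}"
    using assms set_swap_colours_unused[of u T z x] by (auto simp: v_def)
  have w: "length w = Suc k" "distinct w" "set w = T - {y}"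
    using assms v set_swap_colours_unused[of v T x y] by (auto simp: w_def)
  show "extends_to k (omitting k T [x]) u v"
    unfolding v_def using assms by (intro extends_to_omitting) auto
  show "extends_to k (omitting k T [y]) v w"
    unfolding w_def using assms v by (intro extends_to_omitting) auto
  have "extends_to k (omitting k T [z]) w (swap_colours z y w)"
    using assms w by (intro extends_to_omitting) auto
  moreover have "Transposition.transpose z y (Transposition.transpose y x (Transposition.transpose x z c))
      = Transposition.transpose x y c" if "c \<in> set u" for c
    using that assms(3,5,6) by (auto simp: Transposition.transpose_def)
  then have "swap_colours z y w = swap_colours x y u" by (simp add: w_def v_def)
  ultimately show "extends_to k (omitting k T [z]) w (swap_colours x y u)" by simp
  show "length v = Suc k" by (rule v)
qed (rule assms)

text \<open>
  The word of the previous lemma can also be used to restore the colouring if \<open>x\<close> precedes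
  \<open>y\<close>: in the second block \<open>x\<close> has already returned to its place when \<open>y\<close> becomes \<open>z\<close>.
  Repeating the word thus makes the swap optional for both orders of \<open>x\<close> and \<open>y\<close>.
\<close>

lemma extends_to_self:
  assumes "length u = Suc k" "distinct u" "set u = T - {z}" "z \<in> T" "i < j" "j < Suc k"
  shows "extends_to k (omitting k T [u ! i, u ! j, z]) u u"
proof (rule extends_to_three)
  define x y where "x = u ! i" and "y = u ! j"
  define v where "v = swap_colours x z u"
  define w where "w = swap_colours y z u"
  have xy: "x \<in> set u" "y \<in> set u"
    using assms(1,5,6) unfolding x_def y_def by (metis nth_mem less_trans)+
  then have xyT: "x \<in> T" "y \<in> T" using assms(3) by blast+
  have v: "length v = Suc k" "distinct v" "set v = T - {x}"
    using assms(1,2) set_swap_colours_unused[OF assms(3) xyT(1) assms(4)] unfolding v_def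
    by (simp_all only: length_map distinct_swap_colours)
  have w: "length w = Suc k" "distinct w" "set w = T - {y}"
    using assms(1,2) set_swap_colours_unused[OF assms(3) xyT(2) assms(4)] unfolding w_def
    by (simp_all only: length_map distinct_swap_colours)
  have "extends_to k (omitting k T [x]) u v"
    unfolding v_def by (rule extends_to_omitting) (fact assms xyT)+
  then show "extends_to k (omitting k T [u ! i]) u v" by (simp only: x_def)
  have "extends_to k (replicate (Suc k) (T - {y})) v w"
  proof (rule extends_to_block)
    fix i' j' assume ij: "j' < i'" "i' < Suc k"
    have "u ! i' \<in> set u" "u ! j' \<in> set u" using assms(1) ij by (metis nth_mem less_trans)+
    then have "u ! i' \<noteq> z" "u ! j' \<noteq> z" using assms(3) by blast+
    moreover have "u ! j' \<noteq> u ! i'"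
      using assms(1,2) ij by (simp add: nth_eq_iff_index_eq)
    \<comment> \<open>The only common colour of \<open>v\<close> and \<open>w\<close> that changes
      its position is \<open>z\<close>. It moves from \<open>i\<close> to the later position
      \<open>j\<close>, which a block allows.\<close>
    moreover have "\<not> (u ! j' = y \<and> u ! i' = x)"
      using assms(1,2,5,6) ij by (auto simp: x_def y_def nth_eq_iff_index_eq)
    ultimately show "w ! j' \<noteq> v ! i'"
      using ij assms(1) by (auto simp: v_def w_def Transposition.transpose_def)
  qed (use v w in simp_all)
  then show "extends_to k (omitting k T [u ! j]) v w" by (simp del: replicate_Suc add: y_def)
  have "extends_to k (omitting k T [z]) w (swap_colours z y w)"
    by (rule extends_to_omitting) (fact w assms xyT)+
  moreover have "swap_colours z y w = u"
    by (simp add: w_def map_idI transpose_commute[of z y])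
  ultimately show "extends_to k (omitting k T [z]) w u" by simp
  show "length v = Suc k" by (rule v)
qed (rule assms)

lemma extends_to_optional_swap:
  assumes "length u = Suc k" "distinct u" "set u = T - {z}" "z \<in> T" "x \<in> set u" "y \<in> set u"
  shows "extends_to k (omitting k T [x, y, z, x, y, z]) u u"
    and "extends_to k (omitting k T [x, y, z, x, y, z]) u (swap_colours x y u)"
proof -
  define w where "w = swap_colours x y u"
  have w: "length w = Suc k" "distinct w" "set w = set u"
    using assms by (simp_all add: w_def transpose_image_eq)
  have ww: "swap_colours x y w = u" by (simp add: w_def map_idI)
  have uw: "extends_to k (omitting k T [x, y, z]) u w"
    unfolding w_def using assms by (rule extends_to_swap)
  have wu: "extends_to k (omitting k T [x, y, z]) w u"
    using extends_to_swap[of w k T z x y] w assms(3-6) unfolding ww by blast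
  have app: "extends_to k (omitting k T [x, y, z, x, y, z]) u b"
    if "extends_to k (omitting k T [x, y, z]) u a" "extends_to k (omitting k T [x, y, z]) a b" for a b
  proof -
    have "extends_to k (omitting k T [x, y, z] @ omitting k T [x, y, z]) u b"
      using that assms(1) by (intro extends_to_append[of k _ u a]) auto
    then show ?thesis by (simp del: replicate_Suc)
  qed
  obtain i j where ij: "i < Suc k" "j < Suc k" "u ! i = x" "u ! j = y"
    using assms(1,5,6) by (metis in_set_conv_nth)
  consider "x = y" | "i < j" | "j < i" using ij by (cases i j rule: linorder_cases) auto
  then have "extends_to k (omitting k T [x, y, z, x, y, z]) u u \<and>
      extends_to k (omitting k T [x, y, z, x, y, z]) u w"
  proof cases
    case 1
    then have "w = u" by (simp add: w_def)
    then show ?thesis using app[OF uw] uw by simp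
  next
    case 2
    then have "extends_to k (omitting k T [x, y, z]) u u"
      using extends_to_self[of u k T z i j] assms ij by blast
    then show ?thesis using app uw by blast
  next
    case 3
    \<comment> \<open>After a swap \<open>x\<close> precedes \<open>y\<close>, so \<open>w\<close>
      can be kept. A net swap is thus a swap followed by a pause, and swapping twice restores
      \<open>u\<close>.\<close>
    then have "w ! j = x" "w ! i = y" using assms(1) ij by (auto simp: w_def)
    then have "extends_to k (omitting k T [x, y, z]) w w"
      using extends_to_self[of w k T z j i] w assms(3,4) 3 ij by blast
    then show ?thesis using app uw wu by blast
  qed
  then show "extends_to k (omitting k T [x, y, z, x, y, z]) u u"
    "extends_to k (omitting k T [x, y, z, x, y, z]) u (swap_colours x y u)"
    by (simp_all only: w_def)
qed

section \<open>Sorting and synchronizing words\<close>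

text \<open>Each group of six letters offers the swap of \<open>x\<close> with one \<open>y\<close>.
  At most one offer is accepted, so a single word, independent of the wanted \<open>y\<close>,
  reaches all these colourings.\<close>

lemma extends_to_choice_of_swaps:
  assumes "length u = Suc k" "distinct u" "set u = T - {z}" "z \<in> T" "x \<in> set u" "set ys \<subseteq> set u"
    and "v = u \<or> (\<exists>y \<in> set ys. v = swap_colours x y u)"
  shows "extends_to k (omitting k T (concat (map (\<lambda>y. [x, y, z, x, y, z]) ys))) u v"
  using assms
proof (induction ys arbitrary: u)
  case Nil
  then show ?case by (simp add: extends_to_def spaced_short_iff_distinct)
next
  case (Cons a ys)
  \<comment> \<open>The first offer is declined whenever \<open>v\<close> can still be reached by
    the later ones.\<close>
  define t where "t = (if v = u \<or> (\<exists>y \<in> set ys. v = swap_colours x y u) then u else swap_colours x a u)"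
  have "a \<in> set u" using Cons.prems(6) by simp
  then have t: "length t = Suc k" "distinct t" "set t = set u"
    using Cons.prems by (auto simp only: t_def distinct_swap_colours set_swap_colours length_map split: if_splits)
  have "v = t \<or> (\<exists>y \<in> set ys. v = swap_colours x y t)"
    using Cons.prems(7) by (auto simp: t_def)
  then have "extends_to k (omitting k T (concat (map (\<lambda>y. [x, y, z, x, y, z]) ys))) t v"
    using Cons.prems t by (intro Cons.IH) auto
  moreover have "extends_to k (omitting k T [x, a, z, x, a, z]) u t"
    unfolding t_def using extends_to_optional_swap[of u k T z x a] Cons.prems by simp
  ultimately have "extends_to k (omitting k T [x, a, z, x, a, z] @
      omitting k T (concat (map (\<lambda>y. [x, y, z, x, y, z]) ys))) u v"
    using Cons.prems(1) by (intro extends_to_append[of k _ u t]) auto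
  then show ?case by (simp del: replicate_Suc)
qed

text \<open>Selection sort: colour \<open>x = a ! i\<close> is brought to position \<open>i\<close>
  by a swap with the colour found there. That colour depends on \<open>u\<close>, but the word must
  not, so swaps with all \<open>k + 1\<close> colours are offered, at six letters each. Earlier
  positions already agree with \<open>a\<close> and contain neither of the two colours.\<close>

lemma sorting_word:
  assumes "length a = Suc k" "distinct a" "set a = T - {z}" "z \<in> T" "i \<le> Suc k"
  shows "\<exists>ms. length ms = 6 * Suc k * i \<and> set ms \<subseteq> T \<and>
    (\<forall>u. distinct u \<and> set u = set a \<longrightarrow>
      (\<exists>v. distinct v \<and> set v = set a \<and> take i v = take i a \<and> extends_to k (omitting k T ms) u v))"
  using assms(5)
proof (induction i)
  case 0
  have "spaced k u" if "distinct u" "set u = set a" for u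
    using that assms(1,2) by (metis distinct_card order_refl spaced_short_iff_distinct)
  then show ?case by (auto simp: extends_to_def)
next
  case (Suc i)
  then obtain ms where ms: "length ms = 6 * Suc k * i" "set ms \<subseteq> T"
    "\<And>u. distinct u \<Longrightarrow> set u = set a \<Longrightarrow>
      \<exists>v. distinct v \<and> set v = set a \<and> take i v = take i a \<and> extends_to k (omitting k T ms) u v"
    by fastforce
  define x where "x = a ! i"
  define ns where "ns = concat (map (\<lambda>y. [x, y, z, x, y, z]) a)"
  have x: "x \<in> set a" using Suc.prems assms(1) unfolding x_def by (intro nth_mem) simp
  have "\<exists>w. distinct w \<and> set w = set a \<and> take (Suc i) w = take (Suc i) a \<and>
      extends_to k (omitting k T (ms @ ns)) u w" if u: "distinct u" "set u = set a" for u
  proof -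
    obtain v where v: "distinct v" "set v = set a" "take i v = take i a"
      "extends_to k (omitting k T ms) u v"
      using ms(3)[OF u] by blast
    have len: "length u = Suc k" "length v = Suc k"
      using u v(1,2) assms(1,2) by (metis distinct_card)+
    define y where "y = v ! i"
    have "y \<in> set v" using Suc.prems len unfolding y_def by (intro nth_mem) simp
    then have y: "y \<in> set a" using v(2) by blast
    define w where "w = swap_colours x y v"
    have "extends_to k (omitting k T ns) v w"
      unfolding ns_def w_def
      using v len x y assms(3,4) by (intro extends_to_choice_of_swaps) auto
    then have "extends_to k (omitting k T (ms @ ns)) u w"
      using extends_to_append[OF v(4)] len by simp
    moreover have "distinct w" "set w = set a"
      using v x y by (simp_all add: w_def transpose_image_eq)
    moreover have "take (Suc i) w = take (Suc i) a"
    proof (rule nth_equalityI)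
      fix j assume "j < length (take (Suc i) w)"
      then have j: "j \<le> i" "j < Suc k" using len by (auto simp: w_def)
      show "take (Suc i) w ! j = take (Suc i) a ! j"
      proof (cases "j = i")
        case True
        then show ?thesis using j len by (simp add: w_def x_def y_def)
      next
        case False
        then have "v ! j = a ! j" using v(3) j by (metis nth_take le_neq_implies_less)
        moreover have "a ! j \<noteq> x" "v ! j \<noteq> y"
          using False j Suc.prems assms v len
          by (auto simp: x_def y_def nth_eq_iff_index_eq)
        ultimately show ?thesis using False j len by (simp add: w_def)
      qed
    qed (use len assms in \<open>simp add: w_def\<close>)
    ultimately show ?thesis by blast
  qed
  moreover have "length (ms @ ns) = 6 * Suc k * Suc i"
  proof -
    have "length (concat (map (\<lambda>y. [x, y, z, x, y, z]) b)) = 6 * length b" for b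
      by (induction b) auto
    then show ?thesis using ms(1) assms(1) by (simp add: ns_def)
  qed
  moreover have "set (ms @ ns) \<subseteq> T" using ms(2) x assms(3,4) by (auto simp: ns_def)
  ultimately show ?case by blast
qed

text \<open>A leading block with lists \<open>T - {z}\<close>, the outer \<open>Suc\<close> in the
  length, is coloured greedily. Its \<open>k + 1\<close> distinct entries exhaust these
  \<open>k + 1\<close> colours, so they form a permutation of \<open>a\<close>, which the sorting
  word turns into \<open>a\<close>.\<close>

lemma synchronizing_word:
  assumes "card T = k + 2"
  shows "\<exists>Ws a. length Ws = Suc k * Suc (6 * Suc k * Suc k) \<and>
    (\<forall>W \<in> set Ws. W \<subseteq> T \<and> card W = Suc k) \<and> length a = Suc k \<and>
    (\<forall>xs. spaced k xs \<longrightarrow> (\<exists>ys. list_all2 (\<in>) (ys @ a) Ws \<and> spaced k (xs @ ys @ a)))"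
proof -
  have fin: "finite T" using assms by (intro card_ge_0_finite) simp
  obtain z where z: "z \<in> T" using assms by fastforce
  have "finite (T - {z})" "card (T - {z}) = Suc k" using fin z assms by auto
  then obtain a where a: "set a = T - {z}" "distinct a" "length a = Suc k"
    by (metis finite_distinct_list distinct_card)
  from sorting_word[OF a(3,2,1) z order_refl]
  obtain ms where ms: "length ms = 6 * Suc k * Suc k" "set ms \<subseteq> T"
    "\<forall>u. distinct u \<and> set u = set a \<longrightarrow>
      (\<exists>v. distinct v \<and> set v = set a \<and> take (Suc k) v = take (Suc k) a \<and>
        extends_to k (omitting k T ms) u v)"
    by (elim exE conjE) (rule that)
  define Ws where "Ws = omitting k T (z # ms)"
  have "\<exists>ys. list_all2 (\<in>) (ys @ a) Ws \<and> spaced k (xs @ ys @ a)" if "spaced k xs" for xs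
  proof -
    obtain u where u: "list_all2 (\<in>) u (replicate (Suc k) (T - {z}))" "spaced k (xs @ u)"
      using greedy_spaced_extension[OF \<open>spaced k xs\<close>, of "replicate (Suc k) (T - {z})"]
        \<open>card (T - {z}) = Suc k\<close> by (auto simp del: replicate_Suc)
    have len: "length u = Suc k" using list_all2_lengthD[OF u(1)] by simp
    have "distinct u"
      using spaced_appendD2[OF u(2)] len by (simp add: spaced_short_iff_distinct)
    moreover have "set u \<subseteq> set a"
      using u(1) len a(1) by (auto simp: list_all2_conv_all_nth in_set_conv_nth simp del: replicate_Suc)
    ultimately have "set u = set a"
      using a len by (metis List.finite_set card_subset_eq distinct_card)
    then obtain v where v: "set v = set a" "distinct v" "take (Suc k) v = take (Suc k) a"
      "extends_to k (omitting k T ms) u v"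
      using ms(3) \<open>distinct u\<close> by blast
    have "length v = Suc k" using v(1,2) a by (metis distinct_card)
    then have "v = a" using v(3) a(3) by simp
    then obtain ys where ys: "list_all2 (\<in>) ys (omitting k T ms)" "spaced k (u @ ys)"
      "drop (length ys) (u @ ys) = a"
      using v(4) by (auto simp: extends_to_def)
    define us where "us = take (length ys) (u @ ys)"
    have us: "u @ ys = us @ a"
      unfolding us_def using ys(3) append_take_drop_id[of "length ys" "u @ ys"] by simp
    have "list_all2 (\<in>) (u @ ys) Ws"
      unfolding Ws_def using list_all2_appendI[OF u(1) ys(1)] by (simp del: replicate_Suc)
    moreover have "spaced k (xs @ u @ ys)"
      using spaced_append_overlap[OF u(2) ys(2)] len by simp
    ultimately show ?thesis unfolding us by blast
  qed
  moreover have "W \<subseteq> T \<and> card W = Suc k" if "W \<in> set Ws" for W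
  proof -
    obtain m where "m \<in> set (z # ms)" "W = T - {m}"
      using \<open>W \<in> set Ws\<close> unfolding Ws_def by (blast dest: in_set_omittingD)
    then show ?thesis using ms(2) z fin assms by auto
  qed
  moreover have "length Ws = Suc k * Suc (6 * Suc k * Suc k)"
    unfolding Ws_def length_omitting by (simp add: ms(1))
  ultimately show ?thesis using a(3) by blast
qed

section \<open>Closing up the cycle\<close>

text \<open>The cycle is cut open at vertex \<open>w\<close> and \<open>zs\<close> lists the colours
  from there on. Repeating at least \<open>k\<close> entries at the end turns conflicts across the
  cut into conflicts along a path.\<close>

lemma list_colourable_cycle_powerI:
  assumes "length zs = n" "k < n" "k \<le> m" "spaced k (zs @ take m zs)" "w \<le> n"
    and "\<And>i. i < n \<Longrightarrow> zs ! i \<in> L ((w + i) mod n)"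
  shows "list_colourable (with_proj (cycle_power n k)) L"
proof -
  have cyclic: "zs ! i \<noteq> zs ! ((i + d) mod n)" if "i < n" "1 \<le> d" "d \<le> k" for i d
  proof (cases "i + d < n")
    case True
    then show ?thesis
      using spacedD[OF assms(4), of i "i + d"] that assms(1) by (simp add: nth_append)
  next
    case False
    then have "(i + d) mod n = i + d - n" using that assms(2) by (simp add: mod_if)
    moreover have "i + d - n < k" using False that by linarith
    ultimately show ?thesis
      using spacedD[OF assms(4), of i "i + d"] that assms(1-3) False by (simp add: nth_append)
  qed
  \<comment> \<open>The inverse of the rotation by \<open>w\<close>; adding \<open>n - w\<close>
    avoids truncated subtraction.\<close>
  define pos where "pos x = (x + (n - w)) mod n" for x
  define f where "f x = zs ! pos x" for x
  have n: "0 < n" using assms(2) by simp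
  have "f x \<in> L x" if "x < n" for x
  proof -
    have "(w + pos x) mod n = (w + (x + (n - w))) mod n"
      unfolding pos_def by (rule mod_add_right_eq)
    also have "w + (x + (n - w)) = x + n" using assms(5) by simp
    finally have "(w + pos x) mod n = x" using that by simp
    then show ?thesis using assms(6)[of "pos x"] n by (simp add: f_def pos_def)
  qed
  moreover have "f x \<noteq> f y" if xy: "(x, y) \<in> parcs (cycle_power n k)" for x y
  proof -
    have less: "x < n" "y < n" using xy by (auto simp: cycle_power_def)
    \<comment> \<open>Positive offsets suffice: a negative one becomes positive when the two
      vertices are exchanged.\<close>
    have shifted: "f a \<noteq> f b" if d: "1 \<le> d" "d \<le> int k" and ab: "[int b - int a = d] (mod int n)" for a b d
    proof -
      have "[int b = int (a + nat d)] (mod int n)"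
        using ab d by (simp add: cong_iff_dvd_diff algebra_simps)
      then have "[b = a + nat d] (mod n)" by (simp only: cong_int_iff)
      then have "[b + (n - w) = (a + nat d) + (n - w)] (mod n)" by (rule cong_add) simp
      then have "pos b = (a + nat d + (n - w)) mod n" by (simp add: pos_def cong_def)
      also have "a + nat d + (n - w) = a + (n - w) + nat d" by simp
      also have "\<dots> mod n = (pos a + nat d) mod n"
        unfolding pos_def by (rule mod_add_left_eq[symmetric])
      finally have "pos b = (pos a + nat d) mod n" .
      moreover have "pos a < n" using n by (simp add: pos_def)
      ultimately show ?thesis using cyclic[of "pos a" "nat d"] d by (simp add: f_def)
    qed
    have "\<exists>d \<in> {- int k..- 1} \<union> {1..int k}. [int x - int y = d] (mod int n)"
      using xy unfolding cycle_power_def by simp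
    then obtain d where d: "d \<in> {- int k..- 1} \<union> {1..int k}" "[int x - int y = d] (mod int n)"
      by blast
    show ?thesis
    proof (cases "d > 0")
      case True
      then show ?thesis using shifted[of d x y] d by auto
    next
      case False
      have "[int y - int x = - d] (mod int n)"
        using cong_minus_minus_iff[of "int x - int y" d "int n"] d(2) by simp
      then show ?thesis using shifted[of "- d" y x] d False by auto
    qed
  qed
  ultimately have "list_colouring (with_proj (cycle_power n k)) L f"
    by (auto simp: list_colouring_def cycle_power_def arcs_ends_conv)
  then show ?thesis unfolding list_colourable_def by blast
qed

text \<open>The last \<open>k + 1\<close> vertices of the window receive \<open>a\<close>. The
  vertices outside it are coloured greedily from there, and the synchronizing property, applied to
  everything coloured so far, fills the rest of the window so that \<open>a\<close> follows
  again.\<close>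

lemma list_colourable_if_synchronizing_window:
  assumes sync: "\<And>xs. spaced k xs \<Longrightarrow> \<exists>ys. list_all2 (\<in>) (ys @ a) Ws \<and> spaced k (xs @ ys @ a)"
    and a: "length a = Suc k"
    and window: "v + length Ws \<le> n" "\<And>i. i < length Ws \<Longrightarrow> Ws ! i \<subseteq> L (v + i)"
    and L: "\<And>x. x < n \<Longrightarrow> k < card (L x)"
  shows "list_colourable (with_proj (cycle_power n k)) L"
proof -
  define M where "M = length Ws"
  \<comment> \<open>The empty prefix shows that \<open>a\<close> itself is a proper colouring and
    that the window has at least \<open>k + 1\<close> vertices.\<close>
  obtain ys0 where ys0: "list_all2 (\<in>) (ys0 @ a) Ws" "spaced k (ys0 @ a)"
    using sync[of "[]"] by (auto simp: spaced_def)
  have len_ys0: "length ys0 + Suc k = M" using list_all2_lengthD[OF ys0(1)] a by (simp add: M_def)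
  have n: "v + M \<le> n" "k < n" using window(1) len_ys0 by (auto simp: M_def)
  define Vs where "Vs = map (\<lambda>i. L ((v + i) mod n)) [M..<n]"
  have "k < card W" if "W \<in> set Vs" for W
    using that L n(2) by (auto simp: Vs_def)
  then obtain bs where bs: "list_all2 (\<in>) bs Vs" "spaced k (a @ bs)"
    using greedy_spaced_extension[OF spaced_appendD2[OF ys0(2)], of Vs] by blast
  obtain ys where ys: "list_all2 (\<in>) (ys @ a) Ws" "spaced k ((a @ bs) @ ys @ a)"
    using sync[OF bs(2)] by blast
  \<comment> \<open>Reading starts at vertex \<open>v + M - Suc k\<close>, the first one coloured by
    \<open>a\<close>; the first part \<open>ys\<close> of the window comes last.\<close>
  define zs where "zs = a @ bs @ ys"
  have len: "length bs = n - M" "length ys + Suc k = M"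
    using list_all2_lengthD[OF bs(1)] list_all2_lengthD[OF ys(1)] a by (auto simp: Vs_def M_def)
  have in_L: "(ys @ a) ! i \<in> L (v + i)" if "i < M" for i
    using list_all2_nthD2[OF ys(1)] window(2) that unfolding M_def by blast
  show ?thesis
  proof (rule list_colourable_cycle_powerI)
    show "length zs = n" using len n a by (simp add: zs_def)
    show "spaced k (zs @ take (Suc k) zs)" using ys(2) a by (simp add: zs_def)
    show "v + M - Suc k \<le> n" using n by simp
    fix i assume i: "i < n"
    consider "i < Suc k" | i' where "i = Suc k + i'" "i' < n - M" | i' where "i = Suc k + (n - M) + i'"
      by (metis add_less_cancel_left le_Suc_ex not_less)
    then show "zs ! i \<in> L ((v + M - Suc k + i) mod n)"
    proof cases
      case 1
      then have "zs ! i = (ys @ a) ! (length ys + i)" using a by (simp add: zs_def nth_append)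
      then show ?thesis using in_L[of "length ys + i"] 1 len n
        by (simp add: algebra_simps flip: len(2))
    next
      case 2
      then have "zs ! i = bs ! i'" using a len by (simp add: zs_def nth_append)
      moreover have "bs ! i' \<in> Vs ! i'"
        using list_all2_nthD[OF bs(1)] 2 len by simp
      moreover have shift: "v + M - Suc k + i = v + (M + i')" using 2 len by simp
      ultimately show ?thesis unfolding shift using 2 by (simp add: Vs_def)
    next
      case 3
      then have "i' < length ys" using i len n by simp
      then have "zs ! i = (ys @ a) ! i'" using 3 a len by (simp add: zs_def nth_append)
      moreover have shift: "v + M - Suc k + i = v + i' + n" using 3 len n by simp
      moreover have "v + i' < n" using \<open>i' < length ys\<close> n len by simp
      ultimately show ?thesis unfolding shift using in_L[of i'] \<open>i' < length ys\<close> len by simp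
    qed
  qed (use n in auto)
qed

text \<open>The path outside the window is coloured greedily first. Each window vertex then only has
  to avoid the colours of its at most \<open>k\<close> outside neighbours, since disjoint lists rule
  out conflicts inside the window.\<close>

lemma list_colourable_if_disjoint_window:
  assumes n: "v + Suc k \<le> n" "2 * Suc k \<le> n"
    and disj: "\<And>i j. i < j \<Longrightarrow> j < Suc k \<Longrightarrow> L (v + i) \<inter> L (v + j) = {}"
    and L: "\<And>x. x < n \<Longrightarrow> k < card (L x)"
  shows "list_colourable (with_proj (cycle_power n k)) L"
proof -
  define m where "m = n - Suc k"
  define Vs where "Vs = map (\<lambda>i. L ((v + i) mod n)) [Suc k..<n]"
  have "k < card W" if "W \<in> set Vs" for W
    using that L n by (auto simp: Vs_def)
  then obtain bs where bs: "list_all2 (\<in>) bs Vs" "spaced k bs"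
    using greedy_spaced_extension[of k "[]" Vs] by (auto simp: spaced_def)
  have len: "length bs = m" "Suc k \<le> m" "n = m + Suc k"
    using list_all2_lengthD[OF bs(1)] n by (auto simp: Vs_def m_def)
  \<comment> \<open>Reading starts just after the window, so window vertex \<open>i\<close> has
    position \<open>m + i\<close>. Its outside neighbours are the last \<open>k - i\<close> entries
    of \<open>bs\<close> and, across the cut, the first \<open>i\<close> ones.\<close>
  define F where "F i = (!) bs ` ({m - (k - i)..<m} \<union> {..<i})" for i
  have "\<exists>y. y \<in> L (v + i) \<and> y \<notin> F i" if "i < Suc k" for i
  proof -
    have "card (F i) \<le> card ({m - (k - i)..<m} \<union> {..<i})"
      unfolding F_def by (intro card_image_le) simp
    also have "\<dots> \<le> card {m - (k - i)..<m} + card {..<i}" by (rule card_Un_le)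
    also have "\<dots> \<le> k" using that by simp
    also have "k < card (L (v + i))" using L n that by simp
    finally have "\<not> L (v + i) \<subseteq> F i"
      by (metis F_def card_mono finite_Un finite_atLeastLessThan finite_imageI finite_lessThan not_less)
    then show ?thesis by blast
  qed
  then obtain y where y: "\<And>i. i < Suc k \<Longrightarrow> y i \<in> L (v + i)" "\<And>i. i < Suc k \<Longrightarrow> y i \<notin> F i"
    by metis
  define zs where "zs = bs @ map y [0..<Suc k]"
  \<comment> \<open>The repeated prefix lies within \<open>bs\<close>, as \<open>bs\<close> has at
    least \<open>k + 1\<close> entries.\<close>
  have zs: "zs @ take k zs = bs @ map y [0..<Suc k] @ take k bs"
    using len by (simp add: zs_def)
  have nth1: "(zs @ take k zs) ! i = bs ! i" if "i < m" for i
    using that len unfolding zs by (simp add: nth_append)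
  have nth2: "(zs @ take k zs) ! (m + i) = y i" if "i < Suc k" for i
    using that len unfolding zs by (simp add: nth_append del: upt_Suc)
  have nth3: "(zs @ take k zs) ! (m + Suc k + i) = bs ! i" if "i < k" for i
    using that len unfolding zs by (simp add: nth_append del: upt_Suc)
  show ?thesis
  proof (rule list_colourable_cycle_powerI)
    show "length zs = n" using len by (simp add: zs_def)
    show "spaced k (zs @ take k zs)"
      unfolding spaced_def
    proof (intro allI impI)
      fix i j assume *: "i < j \<and> j \<le> i + k \<and> j < length (zs @ take k zs)"
      then have j_less: "j < m + Suc k + k" using len by (simp add: zs_def)
      consider "j < m" | j' where "j = m + j'" "j' < Suc k" | r where "j = m + Suc k + r" "r < k"
        using j_less by (metis add_less_cancel_left le_Suc_ex not_less)
      then show "(zs @ take k zs) ! i \<noteq> (zs @ take k zs) ! j"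
      proof cases
        case 1
        then show ?thesis using * len spacedD[OF bs(2), of i j] by (simp add: nth1)
      next
        case 2
        show ?thesis
        proof (cases "i < m")
          case True
          then have "bs ! i \<in> F j'" unfolding F_def using * 2 by (intro imageI) auto
          then show ?thesis using y(2)[OF 2(2)] nth1[OF True] nth2[OF 2(2)] 2(1) by auto
        next
          case False
          then obtain i' where i': "i = m + i'" using le_Suc_ex not_less by blast
          then have "i' < j'" using * 2 by simp
          then have "y i' \<noteq> y j'" using disj[of i' j'] y(1)[of i'] y(1)[of j'] 2(2) by auto
          then show ?thesis using nth2[of i'] nth2[OF 2(2)] i' 2 \<open>i' < j'\<close> by simp
        qed
      next
        case 3
        have "m < i" using * 3 by simp
        show ?thesis
        proof (cases "i < m + Suc k")
          case True
          then obtain i' where i': "i = m + i'" "i' < Suc k"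
            using \<open>m < i\<close> by (metis add_less_cancel_left le_Suc_ex less_imp_le)
          then have "bs ! r \<in> F i'" unfolding F_def using * 3 by (intro imageI) auto
          then show ?thesis using y(2)[OF i'(2)] nth2[OF i'(2)] nth3[OF 3(2)] 3(1) i'(1) by auto
        next
          case False
          then obtain q where q: "i = m + Suc k + q" using le_Suc_ex not_less by blast
          then have "q < r" using * 3 by simp
          then have "bs ! q \<noteq> bs ! r" using spacedD[OF bs(2), of q r] 3(2) len by simp
          then show ?thesis using nth3[of q] nth3[OF 3(2)] q 3 \<open>q < r\<close> by simp
        qed
      qed
    qed
    show "v + Suc k \<le> n" by (rule n)
    fix i assume i: "i < n"
    show "zs ! i \<in> L ((v + Suc k + i) mod n)"
    proof (cases "i < m")
      case True
      then have "zs ! i = bs ! i" using len by (simp add: zs_def nth_append)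
      moreover have "bs ! i \<in> Vs ! i" using list_all2_nthD[OF bs(1)] True len by simp
      ultimately show ?thesis using True len(3) by (simp add: Vs_def algebra_simps del: upt_Suc)
    next
      case False
      then obtain i' where i': "i = m + i'" using le_Suc_ex not_less by blast
      then have "i' < Suc k" using i len by simp
      then have "zs ! i = y i'" using i' len by (simp add: zs_def nth_append del: upt_Suc)
      moreover have shift: "v + Suc k + i = v + i' + n" using i' len by simp
      moreover have "v + i' < n" using \<open>i' < Suc k\<close> n by simp
      ultimately show ?thesis unfolding shift using y(1)[OF \<open>i' < Suc k\<close>] by simp
    qed
  qed (use n in auto)
qed

section \<open>Probability of favourable windows\<close>

lemma prob_pair_pmf_Times:
  "measure_pmf.prob (pair_pmf p q) (A \<times> B) = measure_pmf.prob p A * measure_pmf.prob q B"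
proof -
  have "measure_pmf.prob (pair_pmf p q) (A \<times> B)
      = measure_pmf.prob (pair_pmf p q) ((A \<inter> set_pmf p) \<times> (B \<inter> set_pmf q))"
    by (subst (1 2) measure_Int_set_pmf[symmetric]) (rule arg_cong2[where f = measure], auto)
  also have "\<dots> = measure_pmf.prob p (A \<inter> set_pmf p) * measure_pmf.prob q (B \<inter> set_pmf q)"
    by (intro measure_pmf_prob_product countable_Int2 countable_set_pmf)
  finally show ?thesis by (simp add: measure_Int_set_pmf)
qed

text \<open>A block is good throughout with probability at least \<open>\<epsilon> ^ M\<close>, and
  the blocks are independent. The induction splits off the last block \<open>B\<close>; the index
  set shrinks to \<open>A - B\<close>, so \<open>A\<close> has to be arbitrary.\<close>

lemma prob_no_good_block_le:
  assumes "finite A" "{..<m * M} \<subseteq> A" "0 \<le> \<epsilon>" "\<And>i. i < M \<Longrightarrow> \<epsilon> \<le> measure_pmf.prob p (E i)"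
  shows "measure_pmf.prob (Pi_pmf A d (\<lambda>_. p)) {f. \<forall>t<m. \<exists>i<M. f (t * M + i) \<notin> E i}
    \<le> (1 - \<epsilon> ^ M) ^ m"
  using assms(1,2)
proof (induction m arbitrary: A)
  case 0
  then show ?case by simp
next
  case (Suc m)
  define B where "B = {m * M..<m * M + M}"
  define X where "X = {f. \<exists>i<M. f (m * M + i) \<notin> E i}"
  define Y where "Y = {f. \<forall>t<m. \<exists>i<M. f (t * M + i) \<notin> E i}"
  have B: "finite B" "B \<subseteq> A" "card B = M" using Suc.prems by (auto simp: B_def)
  have outside: "t * M + i \<notin> B" if "t < m" "i < M" for t i
  proof -
    have "t * M + i < Suc t * M" using that by simp
    also have "\<dots> \<le> m * M" using that by (intro mult_le_mono1) simp
    finally show ?thesis by (simp add: B_def)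
  qed
  have "{..<m * M} \<subseteq> A - B" using Suc.prems by (auto simp: B_def)
  then have Y_le: "measure_pmf.prob (Pi_pmf (A - B) d (\<lambda>_. p)) Y \<le> (1 - \<epsilon> ^ M) ^ m"
    unfolding Y_def using Suc.prems by (intro Suc.IH) auto
  have "\<epsilon> ^ M = (\<Prod>x\<in>B. \<epsilon>)" by (simp add: B)
  also have "\<dots> \<le> (\<Prod>x\<in>B. measure_pmf.prob p (E (x - m * M)))"
    using assms(3,4) by (intro prod_mono) (auto simp: B_def)
  also have "\<dots> = measure_pmf.prob (Pi_pmf B d (\<lambda>_. p)) (PiE_dflt B d (\<lambda>x. E (x - m * M)))"
    by (rule measure_Pi_pmf_PiE_dflt[symmetric]) (rule B)
  also have "\<dots> \<le> measure_pmf.prob (Pi_pmf B d (\<lambda>_. p)) (- X)"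
  proof (rule measure_pmf.finite_measure_mono)
    have "f (m * M + i) \<in> E i" if "f \<in> PiE_dflt B d (\<lambda>x. E (x - m * M))" "i < M" for f i
    proof -
      have "\<forall>x\<in>B. f x \<in> E (x - m * M)" using that(1) by (simp add: PiE_dflt_def)
      moreover have "m * M + i \<in> B" using that(2) by (simp add: B_def)
      ultimately show ?thesis by fastforce
    qed
    then show "PiE_dflt B d (\<lambda>x. E (x - m * M)) \<subseteq> - X" by (auto simp: X_def)
  qed simp
  also have "\<dots> = 1 - measure_pmf.prob (Pi_pmf B d (\<lambda>_. p)) X"
    using measure_pmf.prob_compl[of X "Pi_pmf B d (\<lambda>_. p)"] by (simp add: Compl_eq_Diff_UNIV)
  finally have X_le: "measure_pmf.prob (Pi_pmf B d (\<lambda>_. p)) X \<le> 1 - \<epsilon> ^ M" by simp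
  \<comment> \<open>Nonnegativity of this factor, needed to multiply the two bounds, comes from the
    bound on a probability.\<close>
  then have "0 \<le> 1 - \<epsilon> ^ M" using measure_nonneg order_trans by blast
  let ?h = "\<lambda>(f, g) x. if x \<in> B then f x else g x"
  have "Pi_pmf A d (\<lambda>_. p) = Pi_pmf (B \<union> (A - B)) d (\<lambda>_. p)"
    using B by (simp add: Un_absorb1)
  also have "\<dots> = map_pmf ?h (pair_pmf (Pi_pmf B d (\<lambda>_. p)) (Pi_pmf (A - B) d (\<lambda>_. p)))"
    using B Suc.prems by (intro Pi_pmf_union) auto
  finally have "measure_pmf.prob (Pi_pmf A d (\<lambda>_. p)) {f. \<forall>t<Suc m. \<exists>i<M. f (t * M + i) \<notin> E i}
      = measure_pmf.prob (pair_pmf (Pi_pmf B d (\<lambda>_. p)) (Pi_pmf (A - B) d (\<lambda>_. p)))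
          (?h -` {f. \<forall>t<Suc m. \<exists>i<M. f (t * M + i) \<notin> E i})"
    by (simp only: measure_map_pmf)
  also have "?h -` {f. \<forall>t<Suc m. \<exists>i<M. f (t * M + i) \<notin> E i} = X \<times> Y"
  proof -
    have "m * M + i \<in> B" if "i < M" for i using that by (simp add: B_def)
    then have last: "(\<exists>i<M. ?h (f, g) (m * M + i) \<notin> E i) \<longleftrightarrow> f \<in> X" for f g
      by (auto simp: X_def)
    have earlier: "(\<forall>t<m. \<exists>i<M. ?h (f, g) (t * M + i) \<notin> E i) \<longleftrightarrow> g \<in> Y" for f g
    proof -
      have "(\<exists>i<M. ?h (f, g) (t * M + i) \<notin> E i) \<longleftrightarrow> (\<exists>i<M. g (t * M + i) \<notin> E i)"
        if "t < m" for t
        using outside[OF that] by auto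
      then show ?thesis by (simp add: Y_def)
    qed
    show ?thesis
    proof (rule set_eqI)
      fix p :: "(nat \<Rightarrow> 'a) \<times> (nat \<Rightarrow> 'a)"
      obtain f g where p: "p = (f, g)" by fastforce
      show "p \<in> ?h -` {f. \<forall>t<Suc m. \<exists>i<M. f (t * M + i) \<notin> E i} \<longleftrightarrow> p \<in> X \<times> Y"
        unfolding p vimage_eq mem_Collect_eq All_less_Suc last earlier by (simp add: conj_commute)
    qed
  qed
  also have "measure_pmf.prob (pair_pmf (Pi_pmf B d (\<lambda>_. p)) (Pi_pmf (A - B) d (\<lambda>_. p))) (X \<times> Y)
      \<le> (1 - \<epsilon> ^ M) * (1 - \<epsilon> ^ M) ^ m"
    unfolding prob_pair_pmf_Times using X_le Y_le \<open>0 \<le> 1 - \<epsilon> ^ M\<close>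
    by (intro mult_mono) simp_all
  finally show ?case by simp
qed

text \<open>At least one of the at most \<open>2 ^ card S\<close> equally likely lists contains
  \<open>W\<close>.\<close>

lemma prob_superset_ge:
  assumes "finite S" "W \<subseteq> S" "card W \<le> c" "c \<le> card S"
  shows "1 / 2 ^ card S \<le> measure_pmf.prob (pmf_of_set {A. A \<subseteq> S \<and> card A = c}) {A. W \<subseteq> A}"
proof -
  define X where "X = {A. A \<subseteq> S \<and> card A = c}"
  have "finite X" unfolding X_def using assms(1) by simp
  have "card X = card S choose c" unfolding X_def using assms(1) by (rule n_subsets)
  obtain A where A: "W \<subseteq> A" "A \<subseteq> S" "card A = c"
    using exists_subset_between[OF assms(3,4,2,1)] by blast
  then have "A \<in> X \<inter> {A. W \<subseteq> A}" by (simp add: X_def)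
  then have "1 \<le> card (X \<inter> {A. W \<subseteq> A})"
    using \<open>finite X\<close> by (metis One_nat_def Suc_leI card_gt_0_iff empty_iff finite_Int)
  moreover have "real (card X) \<le> real (2 ^ card S)"
    unfolding \<open>card X = card S choose c\<close> of_nat_le_iff by (rule binomial_le_pow2)
  moreover have "0 < card X" using assms(4) by (simp add: \<open>card X = card S choose c\<close>)
  ultimately have "1 / 2 ^ card S \<le> real (card (X \<inter> {A. W \<subseteq> A})) / real (card X)"
    by (intro frac_le) simp_all
  also have "\<dots> = measure_pmf.prob (pmf_of_set X) {A. W \<subseteq> A}"
    using \<open>finite X\<close> A by (subst measure_pmf_of_set) (auto simp: X_def)
  finally show ?thesis by (simp only: X_def)
qed

text \<open>The probability is \<open>(card B choose c) / (card S choose c)\<close>. Bounding the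
  numerator by \<open>(card B / c) ^ c\<close> from below and the denominator by
  \<open>card S ^ c\<close> from above leaves only the ratio of the two sizes, controlled by
  \<open>q\<close>.\<close>

lemma prob_subset_ge:
  assumes "finite S" "B \<subseteq> S" "c \<le> card B" "card S \<le> q * card B" "0 < c"
  shows "(1 / real (c * q)) ^ c \<le> measure_pmf.prob (pmf_of_set {A. A \<subseteq> S \<and> card A = c}) {A. A \<subseteq> B}"
proof -
  define X where "X = {A. A \<subseteq> S \<and> card A = c}"
  have "finite B" "card B \<le> card S" using assms(1,2) by (auto intro: finite_subset card_mono)
  have "finite X" unfolding X_def using assms(1) by simp
  have card_X: "card X = card S choose c" unfolding X_def using assms(1) by (rule n_subsets)
  have "X \<inter> {A. A \<subseteq> B} = {A. A \<subseteq> B \<and> card A = c}" using assms(2) by (auto simp: X_def)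
  then have card_Int: "card (X \<inter> {A. A \<subseteq> B}) = card B choose c"
    using n_subsets[OF \<open>finite B\<close>] by simp
  have pos: "0 < card B" "0 < card S" using assms(3,5) \<open>card B \<le> card S\<close> by auto
  then have "0 < q" using assms(4) by (cases q) auto
  have "(1 / real (c * q)) ^ c \<le> ((real (card B) / real c) / real (card S)) ^ c"
  proof (rule power_mono)
    have "real (card S) \<le> real (q * card B)" using assms(4) by (simp only: of_nat_le_iff)
    then show "1 / real (c * q) \<le> (real (card B) / real c) / real (card S)"
      using pos assms(5) \<open>0 < q\<close> by (simp add: field_simps)
  qed simp
  also have "\<dots> = (real (card B) / real c) ^ c / real (card S) ^ c" by (rule power_divide)
  also have "\<dots> \<le> real (card B choose c) / real (card S choose c)"
  proof (rule frac_le)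
    show "(real (card B) / real c) ^ c \<le> real (card B choose c)"
      using assms(3) by (rule binomial_ge_n_over_k_pow_k)
    have "card S choose c \<le> card S ^ c" using assms(3) \<open>card B \<le> card S\<close>
      by (intro binomial_le_pow) simp
    then show "real (card S choose c) \<le> real (card S) ^ c"
      by (metis of_nat_le_iff of_nat_power)
    show "0 < real (card S choose c)" using assms(3) \<open>card B \<le> card S\<close> by simp
  qed simp
  also have "\<dots> = measure_pmf.prob (pmf_of_set X) {A. A \<subseteq> B}"
  proof -
    have "0 < card S choose c" using assms(3) \<open>card B \<le> card S\<close> by simp
    then have "X \<noteq> {}" using card_X by auto
    then show ?thesis using \<open>finite X\<close> card_X card_Int by (simp add: measure_pmf_of_set)
  qed
  finally show ?thesis by (simp only: X_def)
qed

section \<open>From favourable windows to the limit\<close>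

text \<open>If no colouring exists, all \<open>n div M\<close> consecutive disjoint windows are
  unfavourable.\<close>

lemma colourable_prob_ge:
  fixes S :: "'a set"
  assumes "finite S" "c \<le> card S" "0 \<le> \<epsilon>"
    and E: "\<And>i. i < M \<Longrightarrow> \<epsilon> \<le> measure_pmf.prob (pmf_of_set {A. A \<subseteq> S \<and> card A = c}) (E i)"
    and good: "\<And>v L. v + M \<le> n \<Longrightarrow> (\<And>i. i < M \<Longrightarrow> L (v + i) \<in> E i) \<Longrightarrow>
      (\<And>x. x < n \<Longrightarrow> L x \<subseteq> S \<and> card (L x) = c) \<Longrightarrow>
      list_colourable (with_proj (cycle_power n k)) L"
  shows "1 - (1 - \<epsilon> ^ M) ^ (n div M) \<le> colourable_prob n c k S"
proof -
  define P where "P = {A. A \<subseteq> S \<and> card A = c}"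
  define R where "R = random_lists n c S"
  define X where "X = {L :: nat \<Rightarrow> 'a set. list_colourable (with_proj (cycle_power n k)) L}"
  define N where "N = {f. \<forall>t<n div M. \<exists>i<M. f (t * M + i) \<notin> E i}"
  have "finite P" unfolding P_def using assms(1) by simp
  moreover have "card P = card S choose c" unfolding P_def using assms(1) by (rule n_subsets)
  then have "P \<noteq> {}" using assms(2) by auto
  ultimately have set_P: "set_pmf (pmf_of_set P) = P" by simp
  have R: "R = Pi_pmf {..<n} {} (\<lambda>_. pmf_of_set P)" by (simp add: R_def random_lists_def P_def)
  \<comment> \<open>Only on the support of \<open>R\<close> is every list known to be a
    \<open>c\<close>-element subset of \<open>S\<close>.\<close>
  have "- X \<inter> set_pmf R \<subseteq> N"
  proof
    fix L assume L: "L \<in> - X \<inter> set_pmf R"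
    then have "L \<in> PiE_dflt {..<n} {} (\<lambda>_. P)" by (simp add: R set_Pi_pmf o_def set_P)
    then have lists: "L x \<subseteq> S \<and> card (L x) = c" if "x < n" for x
      using that by (auto simp: PiE_dflt_def P_def)
    show "L \<in> N"
    proof (rule ccontr)
      assume "L \<notin> N"
      then obtain t where t: "t < n div M" "\<And>i. i < M \<Longrightarrow> L (t * M + i) \<in> E i"
        by (auto simp: N_def)
      have "t * M + M = Suc t * M" by simp
      also have "\<dots> \<le> n div M * M" using t(1) by (intro mult_le_mono1) simp
      also have "\<dots> \<le> n" by simp
      finally show False using good[of "t * M" L] t(2) lists L by (auto simp: X_def)
    qed
  qed
  then have "measure_pmf.prob R (- X) \<le> measure_pmf.prob R N"
    by (subst measure_Int_set_pmf[symmetric]) (auto intro: measure_pmf.finite_measure_mono)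
  also have "\<dots> \<le> (1 - \<epsilon> ^ M) ^ (n div M)"
    unfolding N_def R using assms(3) E[folded P_def]
    by (intro prob_no_good_block_le) (auto intro: less_le_trans)
  finally show ?thesis
    using measure_pmf.prob_compl[of X R]
    by (simp add: Compl_eq_Diff_UNIV colourable_prob_def R_def X_def)
qed

text \<open>A window is favourable if its lists contain those of a synchronizing word over
  \<open>k + 2\<close> fixed colours. The bound \<open>N\<close> on the number of colours makes the
  estimate uniform in \<open>S\<close>.\<close>

lemma colourable_prob_ge_few_colours:
  fixes k :: nat
  defines "M \<equiv> Suc k * Suc (6 * Suc k * Suc k)"
  assumes "finite S" "k < c" "c \<le> card S" "k + 2 \<le> card S" "card S \<le> N"
  shows "1 - (1 - (1 / 2 ^ N) ^ M) ^ (n div M) \<le> colourable_prob n c k S"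
proof -
  obtain T where T: "T \<subseteq> S" "card T = k + 2"
    using obtain_subset_with_card_n[OF assms(5)] by blast
  obtain Ws a where Ws: "length Ws = M" "\<forall>W \<in> set Ws. W \<subseteq> T \<and> card W = Suc k"
    and a: "length a = Suc k"
    and sync: "\<forall>xs. spaced k xs \<longrightarrow> (\<exists>ys. list_all2 (\<in>) (ys @ a) Ws \<and> spaced k (xs @ ys @ a))"
    using synchronizing_word[OF T(2)] unfolding M_def by blast
  show ?thesis
  proof (rule colourable_prob_ge)
    fix i assume "i < M"
    then have "Ws ! i \<in> set Ws" using Ws(1) by simp
    then have W: "Ws ! i \<subseteq> S" "card (Ws ! i) \<le> c" using Ws(2) T(1) assms(3) by auto
    have "(1 :: real) / 2 ^ N \<le> 1 / 2 ^ card S"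
      using assms(6) by (intro divide_left_mono power_increasing) auto
    also have "\<dots> \<le> measure_pmf.prob (pmf_of_set {A. A \<subseteq> S \<and> card A = c}) {A. Ws ! i \<subseteq> A}"
      using assms(2,4) W by (intro prob_superset_ge)
    finally show "1 / 2 ^ N \<le> measure_pmf.prob (pmf_of_set {A. A \<subseteq> S \<and> card A = c}) {A. Ws ! i \<subseteq> A}" .
  next
    fix v L
    assume "v + M \<le> n" "\<And>i. i < M \<Longrightarrow> L (v + i) \<in> {A. Ws ! i \<subseteq> A}"
      "\<And>x. x < n \<Longrightarrow> L x \<subseteq> S \<and> card (L x) = c"
    then show "list_colourable (with_proj (cycle_power n k)) L"
      using sync a Ws(1) assms(3)
      by (intro list_colourable_if_synchronizing_window[of k a Ws v n L]) auto
  qed (use assms in auto)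
qed

text \<open>Fix \<open>k + 1\<close> disjoint classes \<open>B i\<close> of \<open>b\<close> colours
  each. A window is favourable if its \<open>i\<close>-th list lies in \<open>B i\<close>, which
  makes the lists pairwise disjoint.\<close>

lemma colourable_prob_ge_many_colours:
  assumes "finite S" "k < c" "c * Suc k \<le> card S" "2 * Suc k \<le> n"
  shows "1 - (1 - ((1 / real (c * (2 * Suc k))) ^ c) ^ Suc k) ^ (n div Suc k) \<le> colourable_prob n c k S"
proof -
  define b where "b = card S div Suc k"
  have "c \<le> b" unfolding b_def using assms(3) by (simp add: less_eq_div_iff_mult_less_eq)
  obtain h where h: "bij_betw h {0..<card S} S"
    using ex_bij_betw_nat_finite[OF assms(1)] by blast
  define B where "B i = h ` {i * b..<i * b + b}" for i
  have range: "{i * b..<i * b + b} \<subseteq> {0..<card S}" if "i < Suc k" for i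
  proof -
    have "i * b + b = Suc i * b" by simp
    also have "\<dots> \<le> Suc k * b" using that by (intro mult_le_mono1) simp
    also have "\<dots> \<le> card S" unfolding b_def by (rule times_div_less_eq_dividend)
    finally show ?thesis by auto
  qed
  have inj: "inj_on h {0..<card S}" and img: "h ` {0..<card S} = S"
    using h by (auto simp: bij_betw_def)
  have B: "B i \<subseteq> S" "card (B i) = b" if "i < Suc k" for i
    using range[OF that] img inj_on_subset[OF inj range[OF that]]
    by (auto simp: B_def card_image)
  have disj: "B i \<inter> B j = {}" if "i < j" "j < Suc k" for i j
  proof -
    have "i * b + b = Suc i * b" by simp
    also have "\<dots> \<le> j * b" using that by (intro mult_le_mono1) simp
    finally have "{i * b..<i * b + b} \<inter> {j * b..<j * b + b} = {}" by auto
    then show ?thesis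
      unfolding B_def using inj_on_image_Int[OF inj range[of i] range[of j]] that by auto
  qed
  \<comment> \<open>Rounding down in \<open>b\<close> loses at most a factor of two, as
    \<open>b\<close> is positive; hence the ratio \<open>2 * Suc k\<close>.\<close>
  have "card S < Suc k * b + Suc k"
    unfolding b_def by (metis add.commute div_mult_mod_eq mod_less_divisor mult.commute nat_add_left_cancel_less zero_less_Suc)
  moreover have "Suc k \<le> Suc k * b" using \<open>c \<le> b\<close> assms(2) by (cases b) auto
  ultimately have card_S: "card S \<le> 2 * Suc k * b" by simp
  have "c \<le> card S" using assms(3) by (metis le_trans mult_Suc_right le_add1)
  show ?thesis
  proof (rule colourable_prob_ge)
    fix i assume "i < Suc k"
    then show "(1 / real (c * (2 * Suc k))) ^ c
        \<le> measure_pmf.prob (pmf_of_set {A. A \<subseteq> S \<and> card A = c}) {A. A \<subseteq> B i}"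
      using assms(1,2) B \<open>c \<le> b\<close> card_S by (intro prob_subset_ge) simp_all
  next
    fix v L
    assume *: "v + Suc k \<le> n" "\<And>i. i < Suc k \<Longrightarrow> L (v + i) \<in> {A. A \<subseteq> B i}"
      "\<And>x. x < n \<Longrightarrow> L x \<subseteq> S \<and> card (L x) = c"
    show "list_colourable (with_proj (cycle_power n k)) L"
    proof (rule list_colourable_if_disjoint_window)
      fix i j assume "i < j" "j < Suc k"
      then show "L (v + i) \<inter> L (v + j) = {}"
        using *(2)[of i] *(2)[of j] disj[of i j] by auto
    qed (use * assms in auto)
  qed (use assms(1) \<open>c \<le> card S\<close> in auto)
qed

lemma power_div_tendsto_0:
  fixes q :: real
  assumes "0 \<le> q" "q < 1" "0 < M"
  shows "(\<lambda>n. q ^ (n div M)) \<longlonglongrightarrow> 0"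
proof -
  have "filterlim (\<lambda>n. n div M) at_top sequentially"
    unfolding filterlim_at_top
  proof
    fix Z
    show "\<forall>\<^sub>F n in sequentially. Z \<le> n div M"
      using eventually_ge_at_top[of "Z * M"]
      by eventually_elim (use assms(3) in \<open>simp add: less_eq_div_iff_mult_less_eq\<close>)
  qed
  moreover have "(\<lambda>n. q ^ n) \<longlonglongrightarrow> 0" using assms by (intro LIMSEQ_power_zero) simp
  ultimately show ?thesis by (rule filterlim_compose[rotated])
qed

lemma colourable_prob_tendsto_1:
  fixes S :: "nat \<Rightarrow> 'a set"
  assumes "k < c" and S: "\<And>n. n \<ge> 1 \<Longrightarrow> finite (S n) \<and> c \<le> card (S n) \<and> k + 2 \<le> card (S n)"
  shows "(\<lambda>n. colourable_prob n c k (S n)) \<longlonglongrightarrow> 1"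
proof -
  define M where "M = Suc k * Suc (6 * Suc k * Suc k)"
  define q where "q = 1 - (1 / 2 ^ (c * Suc k) :: real) ^ M"
  define r where "r = 1 - ((1 / real (c * (2 * Suc k))) ^ c) ^ Suc k"
  have unit: "0 \<le> 1 - x ^ j \<and> 1 - x ^ j < 1" if "0 < x" "x \<le> 1" for x :: real and j
    using that by (simp add: power_le_one)
  have q: "0 \<le> q" "q < 1" using unit[of "1 / 2 ^ (c * Suc k)" M] by (simp_all add: q_def)
  have "0 < 1 / real (c * (2 * Suc k))" "1 / real (c * (2 * Suc k)) \<le> 1"
    using assms(1) by (simp_all add: Suc_le_eq flip: of_nat_mult of_nat_Suc)
  then have "0 < (1 / real (c * (2 * Suc k))) ^ c" "(1 / real (c * (2 * Suc k))) ^ c \<le> 1"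
    by (simp_all only: zero_less_power power_le_one less_imp_le)
  then have r: "0 \<le> r" "r < 1" unfolding r_def using unit by blast+
  \<comment> \<open>The size of \<open>S n\<close> may alternate between the two regimes, so both
    error terms are subtracted for every \<open>n\<close>.\<close>
  have "1 - q ^ (n div M) - r ^ (n div Suc k) \<le> colourable_prob n c k (S n)" if "n \<ge> 2 * Suc k" for n
  proof (cases "card (S n) \<le> c * Suc k")
    case True
    have "1 - q ^ (n div M) \<le> colourable_prob n c k (S n)"
      unfolding q_def M_def using S[of n] that True assms(1)
      by (intro colourable_prob_ge_few_colours) auto
    moreover have "0 \<le> r ^ (n div Suc k)" using r by simp
    ultimately show ?thesis by linarith
  next
    case False
    have "1 - r ^ (n div Suc k) \<le> colourable_prob n c k (S n)"
      unfolding r_def using S[of n] that False assms(1)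
      by (intro colourable_prob_ge_many_colours) auto
    moreover have "0 \<le> q ^ (n div M)" using q by simp
    ultimately show ?thesis by linarith
  qed
  then have lower: "\<forall>\<^sub>F n in sequentially.
      1 - q ^ (n div M) - r ^ (n div Suc k) \<le> colourable_prob n c k (S n)"
    by (rule eventually_sequentiallyI)
  have "(\<lambda>n. 1 - q ^ (n div M) - r ^ (n div Suc k)) \<longlonglongrightarrow> 1 - 0 - 0"
    by (intro tendsto_diff tendsto_const power_div_tendsto_0 q r) (simp_all add: M_def)
  then show ?thesis
    by (intro tendsto_sandwich[OF lower _ _ tendsto_const]) (simp_all add: colourable_prob_def)
qed

theorem theorem3p2:
  fixes c k :: nat and s :: "nat \<Rightarrow> nat" and S :: "nat \<Rightarrow> 'a set"
  assumes "c \<ge> 1" and "k \<ge> 1"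
    and "\<And>n. n \<ge> 1 \<Longrightarrow> s n \<ge> 1"
    and "\<And>n. n \<ge> 1 \<Longrightarrow> finite (S n) \<and> card (S n) = s n"
  shows "(c = k + 1 \<and> (\<forall>n\<ge>1. s n > c) \<longrightarrow> (\<lambda>n. colourable_prob n c k (S n)) \<longlonglongrightarrow> 1) \<and>
         (c > k + 1 \<and> (\<forall>n\<ge>1. s n \<ge> c) \<longrightarrow> (\<lambda>n. colourable_prob n c k (S n)) \<longlonglongrightarrow> 1)"
proof (intro conjI impI)
  assume *: "c = k + 1 \<and> (\<forall>n\<ge>1. s n > c)"
  have "finite (S n) \<and> c \<le> card (S n) \<and> k + 2 \<le> card (S n)" if "n \<ge> 1" for n
  proof -
    \<comment> \<open>Here the spare colour of the puzzle comes from
      \<open>s n > c = k + 1\<close>.\<close>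
    have "c < s n" using * that by blast
    then show ?thesis using * assms(4)[OF that] by simp
  qed
  then show "(\<lambda>n. colourable_prob n c k (S n)) \<longlonglongrightarrow> 1"
    using * by (intro colourable_prob_tendsto_1) auto
next
  assume *: "c > k + 1 \<and> (\<forall>n\<ge>1. s n \<ge> c)"
  have "finite (S n) \<and> c \<le> card (S n) \<and> k + 2 \<le> card (S n)" if "n \<ge> 1" for n
  proof -
    \<comment> \<open>Here a single list already has at least \<open>k + 2\<close> colours.\<close>
    have "c \<le> s n" using * that by blast
    then show ?thesis using * assms(4)[OF that] by simp
  qed
  then show "(\<lambda>n. colourable_prob n c k (S n)) \<longlonglongrightarrow> 1"
    using * by (intro colourable_prob_tendsto_1) auto
qed

end
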